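(* Let $a_i,b_i\in\mathbb{R}^3$, $i=1,\dots,N$, obey the generative model $b_i=sRa_i+t+o_i+\epsilon_i$ with $s>0$, $R\in SO(3)$, $t\in\mathbb{R}^3$, $o_i,\epsilon_i\in\mathbb{R}^3$. Let $a\in\mathbb{R}^{3N}$ (resp. $b\in\mathbb{R}^{3N}$) be obtained by concatenating all vectors $a_i$ (resp. $b_i$) in a single column vector. Let $\mathcal G$ be an arbitrary graph with nodes $\{1,\dots,N\}$ and an arbitrary set of edges $\mathcal E$, and let $A\in\mathbb{R}^{|\mathcal E|\times N}$ be its incidence matrix. Then the vectors $\bar a=(A\otimes I_3)a$ and $\bar b=(A\otimes I_3)b$ are translation invariant measurements.
   Context: Edges are oriented arbitrarily; the row of the incidence matrix $A$ corresponding to an edge $(i,j)$ has entry $-1$ in column $i$, $+1$ in column $j$ and $0$ elsewhere. $\otimes$ is the Kronecker product. Vectors $\bar a,\bar b\in\mathbb{R}^{3|\mathcal E|}$ formed from the data are called translation invariant measurements (TIMs) if their relation does not depend on the translation $t$, in the sense that, with $o$ and $\epsilon$ the stacked vectors of the $o_i$ and $\epsilon_i$, $\bar b=s(I_{|\mathcal E|}\otimes R)\bar a+(A\otimes I_3)(o+\epsilon)$; i.e. for each edge $(i,j)$ the corresponding 3D blocks satisfy $\bar b_{ij}=sR\bar a_{ij}+o_{ij}+\epsilon_{ij}$ with $o_{ij}=o_j-o_i$, $\epsilon_{ij}=\epsilon_j-\epsilon_i$. *)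

theory Defs
  imports Jordan_Normal_Form.Matrix Jordan_Normal_Form.Determinant
begin

definition special_orthogonal :: "nat \<Rightarrow> real mat set" where
  "special_orthogonal n = {R \<in> carrier_mat n n. transpose_mat R * R = 1\<^sub>m n \<and> det R = 1}"

definition kronecker :: "real mat \<Rightarrow> real mat \<Rightarrow> real mat" (infixl \<open>\<otimes>\<^sub>K\<close> 70) where
  "A \<otimes>\<^sub>K B = mat (dim_row A * dim_row B) (dim_col A * dim_col B)
     (\<lambda>(r, c). A $$ (r div dim_row B, c div dim_col B) * B $$ (r mod dim_row B, c mod dim_col B))"

text \<open>The column vector in dimension \<open>3 * N\<close> that concatenates \<open>x 1, ..., x N\<close>. Nodes are
  numbered from 1, whereas vector and matrix indices start at 0.\<close>

definition stack :: "nat \<Rightarrow> (nat \<Rightarrow> real vec) \<Rightarrow> real vec" where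
  "stack N x = vec (3 * N) (\<lambda>k. x (k div 3 + 1) $ (k mod 3))"

definition block :: "real vec \<Rightarrow> nat \<Rightarrow> real vec" where
  "block v k = vec 3 (\<lambda>r. v $ (3 * k + r))"

definition graph_on :: "nat \<Rightarrow> nat set set \<Rightarrow> bool" where
  "graph_on N E \<longleftrightarrow> (\<forall>e\<in>E. e \<subseteq> {1..N} \<and> card e = 2)"

text \<open>A list that contains every edge exactly once, in one of its two orientations. The position
  of an edge in the list is its row in the incidence matrix.\<close>

definition orientation_of :: "nat set set \<Rightarrow> (nat \<times> nat) list \<Rightarrow> bool" where
  "orientation_of E es \<longleftrightarrow>
     distinct (map (\<lambda>(i, j). {i, j}) es) \<and> set (map (\<lambda>(i, j). {i, j}) es) = E"

definition incidence_matrix :: "nat \<Rightarrow> (nat \<times> nat) list \<Rightarrow> real mat" where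
  "incidence_matrix N es = mat (length es) N
     (\<lambda>(r, c). if c + 1 = fst (es ! r) then -1 else if c + 1 = snd (es ! r) then 1 else 0)"

text \<open>The arguments \<open>p\<close> and \<open>\<epsilon>\<close> are the families of outlier and noise vectors. The relation between
  \<open>u\<close> and \<open>v\<close> (the vectors usually written with a bar over \<open>a\<close> and \<open>b\<close>) is required both in its
  stacked form and edge by edge; no translation occurs in it.\<close>

definition translation_invariant_measurements ::
  "nat \<Rightarrow> (nat \<times> nat) list \<Rightarrow> real \<Rightarrow> real mat \<Rightarrow> (nat \<Rightarrow> real vec) \<Rightarrow> (nat \<Rightarrow> real vec) \<Rightarrow>
   real vec \<Rightarrow> real vec \<Rightarrow> bool" where
  "translation_invariant_measurements N es s R p \<epsilon> u v \<longleftrightarrow>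
     u \<in> carrier_vec (3 * length es) \<and> v \<in> carrier_vec (3 * length es) \<and>
     v = (s \<cdot>\<^sub>m (1\<^sub>m (length es) \<otimes>\<^sub>K R)) *\<^sub>v u
         + (incidence_matrix N es \<otimes>\<^sub>K 1\<^sub>m 3) *\<^sub>v (stack N p + stack N \<epsilon>) \<and>
     (\<forall>k<length es. case es ! k of (i, j) \<Rightarrow>
        block v k = s \<cdot>\<^sub>v (R *\<^sub>v block u k) + (p j - p i) + (\<epsilon> j - \<epsilon> i))"

end

theory Submission
  imports Defs
begin

text \<open>Every row of the incidence matrix sums to zero, so a constant family is annihilated and
  the translation disappears. The block of \<open>(A \<otimes>\<^sub>K 1\<^sub>m 3) *\<^sub>v stack N x\<close> at the edge \<open>(i, j)\<close>
  is \<open>x j - x i\<close>, and \<open>1\<^sub>m m \<otimes>\<^sub>K R\<close> acts as \<open>R\<close> on each block; both facts are instances of the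
  blockwise description of multiplication by a Kronecker product.\<close>

lemma dim_block [simp]: "dim_vec (block v k) = 3"
  by (simp add: block_def)

lemma index_block [simp]: "r < 3 \<Longrightarrow> block v k $ r = v $ (3 * k + r)"
  by (simp add: block_def)

lemma block_in_carrier [simp]: "block v k \<in> carrier_vec 3"
  by (simp add: carrier_vecI)

text \<open>Each index \<open>q\<close> is \<open>3 * (q div 3) + q mod 3\<close>, so the blocks
  exhaust the vector. This turns the stacked relation into one equation per edge.\<close>

lemma eq_vec_blockI:
  assumes "u \<in> carrier_vec (3 * m)" "v \<in> carrier_vec (3 * m)"
    and "\<And>k. k < m \<Longrightarrow> block u k = block v k"
  shows "u = v"
proof (rule eq_vecI)
  fix q assume "q < dim_vec v"
  then have "q div 3 < m" using assms(2) by auto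
  then have "block u (q div 3) $ (q mod 3) = block v (q div 3) $ (q mod 3)"
    using assms(3) by simp
  then show "u $ q = v $ q" by simp
qed (use assms in auto)

lemma block_add:
  assumes "v \<in> carrier_vec (3 * m)" "k < m"
  shows "block (u + v) k = block u k + block v k"
  using assms by (intro eq_vecI) auto

lemma block_smult:
  assumes "v \<in> carrier_vec (3 * m)" "k < m"
  shows "block (c \<cdot>\<^sub>v v) k = c \<cdot>\<^sub>v block v k"
  using assms by (intro eq_vecI) auto

lemma stack_in_carrier [simp]: "stack N x \<in> carrier_vec (3 * N)"
  by (simp add: stack_def)

lemma block_stack:
  assumes "c < N" "x (Suc c) \<in> carrier_vec 3"
  shows "block (stack N x) c = x (Suc c)"
  using assms by (intro eq_vecI) (auto simp: stack_def)

text \<open>The dimension of \<open>x i + y i\<close> is that of the right summand, which is why the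
  assumption concerns \<open>y\<close>.\<close>

lemma stack_add:
  assumes "\<And>i. i \<in> {1..N} \<Longrightarrow> y i \<in> carrier_vec 3"
  shows "stack N x + stack N y = stack N (\<lambda>i. x i + y i)"
proof (rule eq_vecI)
  fix q assume "q < dim_vec (stack N (\<lambda>i. x i + y i))"
  then have "q < 3 * N" by (simp add: stack_def)
  moreover from this have "y (Suc (q div 3)) \<in> carrier_vec 3" by (intro assms) auto
  ultimately show "(stack N x + stack N y) $ q = stack N (\<lambda>i. x i + y i) $ q"
    by (simp add: stack_def)
qed (simp add: stack_def)

lemma kronecker_in_carrier:
  assumes "A \<in> carrier_mat m n" "B \<in> carrier_mat k l"
  shows "A \<otimes>\<^sub>K B \<in> carrier_mat (m * k) (n * l)"
  using assms by (simp add: kronecker_def)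

lemma kronecker_mult_vec_in_carrier:
  assumes "A \<in> carrier_mat m n" "B \<in> carrier_mat 3 3"
  shows "(A \<otimes>\<^sub>K B) *\<^sub>v v \<in> carrier_vec (3 * m)"
  using kronecker_in_carrier[OF assms] by (intro carrier_vecI) (simp add: mult.commute)

text \<open>The entry of \<open>A \<otimes>\<^sub>K B\<close> in row \<open>3 * k + d\<close> and
  column \<open>3 * c + e\<close> is \<open>A $$ (k, c) * B $$ (d, e)\<close>. Grouping the columns
  in threes therefore makes the sum over \<open>e\<close> an entry of
  \<open>B *\<^sub>v block v c\<close>.\<close>

lemma block_kronecker_mult_vec:
  assumes A: "A \<in> carrier_mat m n" and B: "B \<in> carrier_mat 3 3"
    and v: "v \<in> carrier_vec (3 * n)" and k: "k < m" and d: "d < 3"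
  shows "block ((A \<otimes>\<^sub>K B) *\<^sub>v v) k $ d = (\<Sum>c<n. A $$ (k, c) * (B *\<^sub>v block v c) $ d)"
proof -
  have row: "3 * k + d < m * 3" using k d by linarith
  define f where "f q = (A \<otimes>\<^sub>K B) $$ (3 * k + d, q) * v $ q" for q
  have f: "f (c * 3 + e) = A $$ (k, c) * (B $$ (d, e) * v $ (3 * c + e))"
    if "c < n" "e < 3" for c e
  proof -
    have "c * 3 + e < n * 3" using that by linarith
    then show ?thesis
      using A B row d that by (simp add: f_def kronecker_def mult.commute[of c])
  qed
  have "block ((A \<otimes>\<^sub>K B) *\<^sub>v v) k $ d = sum f {..<n * 3}"
    using kronecker_in_carrier[OF A B] row v d
    by (simp add: scalar_prod_def f_def atLeast0LessThan mult.commute[of 3 n])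
  \<comment> \<open>The index range is cut into \<open>n\<close> consecutive intervals of length 3,
    each then shifted to start at 0.\<close>
  also have "\<dots> = (\<Sum>c<n. \<Sum>e<3. f (c * 3 + e))"
    by (simp add: sum.nat_group[symmetric] sum.atLeastLessThan_shift_0 atLeast0LessThan)
  also have "\<dots> = (\<Sum>c<n. A $$ (k, c) * (B *\<^sub>v block v c) $ d)"
    using B d by (simp add: f scalar_prod_def sum_distrib_left atLeast0LessThan)
  finally show ?thesis .
qed

lemma block_one_kronecker_mult_vec:
  assumes R: "R \<in> carrier_mat 3 3" and v: "v \<in> carrier_vec (3 * m)" and k: "k < m"
  shows "block ((1\<^sub>m m \<otimes>\<^sub>K R) *\<^sub>v v) k = R *\<^sub>v block v k"
proof (rule eq_vecI)
  fix d assume "d < dim_vec (R *\<^sub>v block v k)"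
  then have d: "d < 3" using R by simp
  have "block ((1\<^sub>m m \<otimes>\<^sub>K R) *\<^sub>v v) k $ d
      = (\<Sum>c<m. if c = k then (R *\<^sub>v block v c) $ d else 0)"
    unfolding block_kronecker_mult_vec[OF one_carrier_mat R v k d]
    using k by (intro sum.cong) auto
  then show "block ((1\<^sub>m m \<otimes>\<^sub>K R) *\<^sub>v v) k $ d = (R *\<^sub>v block v k) $ d"
    using k by simp
qed (use R in simp)

lemma incidence_matrix_in_carrier [simp]:
  "incidence_matrix N es \<in> carrier_mat (length es) N"
  by (simp add: incidence_matrix_def)

text \<open>Row \<open>k\<close> of the incidence matrix has just the two entries -1 and 1, at the
  endpoints of the edge. For a loop the nested conditional would yield a lone -1, hence
  \<open>i \<noteq> j\<close>.\<close>

lemma block_incidence_kronecker_mult_stack: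
  assumes x: "\<And>l. l \<in> {1..N} \<Longrightarrow> x l \<in> carrier_vec 3"
    and k: "k < length es" and e: "es ! k = (i, j)"
    and i: "i \<in> {1..N}" and j: "j \<in> {1..N}" and "i \<noteq> j"
  shows "block ((incidence_matrix N es \<otimes>\<^sub>K 1\<^sub>m 3) *\<^sub>v stack N x) k = x j - x i"
proof (rule eq_vecI)
  fix d assume "d < dim_vec (x j - x i)"
  then have d: "d < 3" using x[OF i] by simp
  have "block ((incidence_matrix N es \<otimes>\<^sub>K 1\<^sub>m 3) *\<^sub>v stack N x) k $ d
      = (\<Sum>c<N. incidence_matrix N es $$ (k, c) * x (Suc c) $ d)"
    unfolding block_kronecker_mult_vec[OF incidence_matrix_in_carrier one_carrier_mat
        stack_in_carrier k d]
    by (intro sum.cong refl) (simp add: block_stack x)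
  \<comment> \<open>Node \<open>i\<close> belongs to column \<open>i - 1\<close>; the truncated
    subtraction is exact because nodes are at least 1.\<close>
  also have "\<dots> = (\<Sum>c<N. (if c = j - 1 then x j $ d else 0) - (if c = i - 1 then x i $ d else 0))"
    using k e i j \<open>i \<noteq> j\<close> by (intro sum.cong refl) (auto simp: incidence_matrix_def)
  also have "\<dots> = x j $ d - x i $ d"
  proof -
    have "i - 1 < N" "j - 1 < N" using i j by auto
    then show ?thesis by (simp add: sum_subtractf)
  qed
  finally show "block ((incidence_matrix N es \<otimes>\<^sub>K 1\<^sub>m 3) *\<^sub>v stack N x) k $ d = (x j - x i) $ d"
    using d x[OF i] x[OF j] by simp
qed (use x[OF i] in simp)

text \<open>Loops are excluded by cardinality: \<open>{i, i}\<close> has one element, whereas edges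
  have two.\<close>

lemma orientation_of_nth:
  assumes "graph_on N E" "orientation_of E es" "k < length es" "es ! k = (i, j)"
  shows "i \<in> {1..N}" "j \<in> {1..N}" "i \<noteq> j"
proof -
  have "(i, j) \<in> set es" using assms(3,4) by (metis nth_mem)
  then have "{i, j} \<in> E" using assms(2) by (force simp: orientation_of_def)
  then have "{i, j} \<subseteq> {1..N} \<and> card {i, j} = 2" using assms(1) unfolding graph_on_def by blast
  then show "i \<in> {1..N}" "j \<in> {1..N}" "i \<noteq> j" by auto
qed

theorem theorem4:
  fixes N :: nat and a b p \<epsilon> :: "nat \<Rightarrow> real vec" and s :: real and R :: "real mat"
    and t :: "real vec" and E :: "nat set set" and es :: "(nat \<times> nat) list"
  assumes "\<And>i. i \<in> {1..N} \<Longrightarrow> a i \<in> carrier_vec 3"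
    and "\<And>i. i \<in> {1..N} \<Longrightarrow> b i \<in> carrier_vec 3"
    and "\<And>i. i \<in> {1..N} \<Longrightarrow> p i \<in> carrier_vec 3"
    and "\<And>i. i \<in> {1..N} \<Longrightarrow> \<epsilon> i \<in> carrier_vec 3"
    and "s > 0"
    and "R \<in> special_orthogonal 3"
    and "t \<in> carrier_vec 3"
    and "\<And>i. i \<in> {1..N} \<Longrightarrow> b i = s \<cdot>\<^sub>v (R *\<^sub>v a i) + t + p i + \<epsilon> i"
    and "graph_on N E"
    and "orientation_of E es"
  shows "translation_invariant_measurements N es s R p \<epsilon>
           ((incidence_matrix N es \<otimes>\<^sub>K 1\<^sub>m 3) *\<^sub>v stack N a)
           ((incidence_matrix N es \<otimes>\<^sub>K 1\<^sub>m 3) *\<^sub>v stack N b)"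
proof -
  let ?m = "length es"
  let ?D = "incidence_matrix N es \<otimes>\<^sub>K 1\<^sub>m 3"
  let ?u = "?D *\<^sub>v stack N a" and ?v = "?D *\<^sub>v stack N b"
  let ?w = "?D *\<^sub>v (stack N p + stack N \<epsilon>)"
  let ?M = "1\<^sub>m ?m \<otimes>\<^sub>K R"
  note a = assms(1) and b = assms(2) and p = assms(3) and eps = assms(4) and t = assms(7)
    and model = assms(8)
  have R: "R \<in> carrier_mat 3 3" using assms(6) by (simp add: special_orthogonal_def)
  \<comment> \<open>As a single stack, the perturbation falls under
    \<open>block_incidence_kronecker_mult_stack\<close>.\<close>
  have noise_stack: "stack N p + stack N \<epsilon> = stack N (\<lambda>l. p l + \<epsilon> l)"
    by (rule stack_add) (rule eps)
  have D: "?D *\<^sub>v x \<in> carrier_vec (3 * ?m)" for x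
    by (rule kronecker_mult_vec_in_carrier[OF incidence_matrix_in_carrier one_carrier_mat])
  have M: "?M *\<^sub>v x \<in> carrier_vec (3 * ?m)" for x
    by (rule kronecker_mult_vec_in_carrier[OF one_carrier_mat R])
  have edge: "block ?v k = s \<cdot>\<^sub>v (R *\<^sub>v block ?u k) + (p j - p i) + (\<epsilon> j - \<epsilon> i)"
    and noise: "block ?w k = (p j - p i) + (\<epsilon> j - \<epsilon> i)"
    if k: "k < ?m" and e: "es ! k = (i, j)" for k i j
  proof -
    note ij = orientation_of_nth[OF assms(9,10) k e]
    note blk = block_incidence_kronecker_mult_stack[OF _ k e ij]
    note car = a[OF ij(1)] a[OF ij(2)] p[OF ij(1)] p[OF ij(2)] eps[OF ij(1)] eps[OF ij(2)] t
    have "R *\<^sub>v (a j - a i) = R *\<^sub>v a j - R *\<^sub>v a i"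
      using R car by (intro mult_minus_distrib_mat_vec)
    \<comment> \<open>The blocks are \<open>b j - b i\<close> and \<open>a j - a i\<close>.
      Substituting \<open>model\<close> at both nodes cancels \<open>t\<close>. The two deleted
      rules would rewrite the memberships \<open>ij\<close> on which \<open>model\<close>
      depends.\<close>
    then show "block ?v k = s \<cdot>\<^sub>v (R *\<^sub>v block ?u k) + (p j - p i) + (\<epsilon> j - \<epsilon> i)"
      using car R by (simp add: blk[OF a] blk[OF b] model ij del: One_nat_def atLeastAtMost_iff)
        (intro eq_vecI, auto simp: algebra_simps)
    have "block ?w k = (p j + \<epsilon> j) - (p i + \<epsilon> i)"
      using block_incidence_kronecker_mult_stack[where x = "\<lambda>l. p l + \<epsilon> l", OF _ k e ij] p eps
      by (simp add: noise_stack)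
    then show "block ?w k = (p j - p i) + (\<epsilon> j - \<epsilon> i)"
      using car by (intro eq_vecI) auto
  qed
  \<comment> \<open>On block \<open>k\<close> this is \<open>edge\<close> with its last two summands
    replaced by \<open>noise\<close>.\<close>
  have "?v = s \<cdot>\<^sub>v (?M *\<^sub>v ?u) + ?w"
  proof (rule eq_vec_blockI)
    fix k assume k: "k < ?m"
    obtain i j where e: "es ! k = (i, j)" by fastforce
    note ij = orientation_of_nth[OF assms(9,10) k e]
    note car = p[OF ij(1)] p[OF ij(2)] eps[OF ij(1)] eps[OF ij(2)]
    have "block (s \<cdot>\<^sub>v (?M *\<^sub>v ?u) + ?w) k = s \<cdot>\<^sub>v (R *\<^sub>v block ?u k) + block ?w k"
      by (simp add: block_add[OF D k] block_smult[OF M k] block_one_kronecker_mult_vec[OF R D k])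
    then show "block ?v k = block (s \<cdot>\<^sub>v (?M *\<^sub>v ?u) + ?w) k"
      unfolding edge[OF k e] noise[OF k e] using car R by (intro eq_vecI) auto
  qed (use D M in auto)
  \<comment> \<open>Blocks were computed with the scalar on the vector; the definition puts it on
    the matrix. Row by row, \<open>s\<close> moves through the scalar product.\<close>
  also have "s \<cdot>\<^sub>v (?M *\<^sub>v ?u) = (s \<cdot>\<^sub>m ?M) *\<^sub>v ?u"
    using kronecker_in_carrier[OF one_carrier_mat R, of ?m] D[of "stack N a"]
    by (intro eq_vecI) (auto simp: mult.commute[of 3] smult_scalar_prod_distrib[of _ "?m * 3"])
  finally have stacked: "?v = (s \<cdot>\<^sub>m ?M) *\<^sub>v ?u + ?w" .
  have "case es ! k of (i, j) \<Rightarrow>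
      block ?v k = s \<cdot>\<^sub>v (R *\<^sub>v block ?u k) + (p j - p i) + (\<epsilon> j - \<epsilon> i)"
    if "k < ?m" for k
    using edge[OF that] by (cases "es ! k") simp
  then show ?thesis
    unfolding translation_invariant_measurements_def
    by (intro conjI allI impI D stacked)
qed

end
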